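(* Let $n\ge 2$ and let $G$ be a proper subdomain of $\mathbb{R}^n$ whose boundary $\partial G$ is compact and $Q$-regular for some $Q\in(0,n)$. For each $x\in G$ there exists a constant $C<\infty$, which depends only on the $Q$-regularity data of $\partial G$ and on $d(x)$, such that for all sufficiently large $r$, $$\mathrm{vol}_k(B_k(x,r))\le C e^{Qr}.$$
   Context: For a proper subdomain $G\subset\mathbb{R}^n$ write $d(z)=d(z,\partial G)$ for the Euclidean distance from $z\in G$ to $\partial G$. The quasihyperbolic distance is $k_G(x,y)=\inf_{\alpha}\int_\alpha \frac{|dz|}{d(z)}$, the infimum being over all rectifiable curves $\alpha$ in $G$ joining $x$ and $y$. The quasihyperbolic ball is $B_k(x,r)=\{z\in G: k_G(x,z)<r\}$. The quasihyperbolic volume of a Lebesgue measurable set $A\subset G$ is $\mathrm{vol}_k(A)=\int_A \frac{dm(z)}{d(z)^n}$, where $m$ is $n$-dimensional Lebesgue measure. A set $E\subset\mathbb{R}^n$ is $Q$-regular ($0<Q<n$) if there is a (Borel regular, outer) measure $\mu$ with $\operatorname{spt}(\mu)=E$ (the smallest closed set of full $\mu$-measure) and constants $0<\alpha\le\beta<\infty$ such that $\alpha r^Q\le\mu(B^n(x,r))\le\beta r^Q$ for all $x\in E$ and $0<r<\operatorname{diam}(E)$, where $B^n(x,r)$ is the open Euclidean ball. The $Q$-regularity data are $n,Q,\alpha,\beta$ and $\operatorname{diam}(E)$. *)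

theory Defs
  imports "HOL-Analysis.Analysis"
begin

section \<open>Regular sets\<close>

text \<open>An outer measure on all subsets of the space. The library's \<open>outer_measure_space\<close> asks
  for countable subadditivity on disjoint families only; as all subsets are admitted, this
  together with monotonicity gives it for arbitrary sequences of sets.\<close>

definition borel_regular_outer_measure :: "('a::topological_space set \<Rightarrow> ennreal) \<Rightarrow> bool" where
  "borel_regular_outer_measure \<mu> \<longleftrightarrow>
     outer_measure_space UNIV \<mu> \<and>
     sets borel \<subseteq> lambda_system UNIV UNIV \<mu> \<and>
     (\<forall>A. \<exists>B \<in> sets borel. A \<subseteq> B \<and> \<mu> B = \<mu> A)"

text \<open>\<open>E\<close> is the smallest closed set of full \<open>\<mu>\<close>-measure.\<close>

definition is_spt :: "('a::topological_space set \<Rightarrow> ennreal) \<Rightarrow> 'a set \<Rightarrow> bool" where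
  "is_spt \<mu> E \<longleftrightarrow>
     closed E \<and> \<mu> (- E) = 0 \<and> (\<forall>F. closed F \<and> \<mu> (- F) = 0 \<longrightarrow> E \<subseteq> F)"

text \<open>The library's \<open>diameter\<close> is real-valued and meaningful only for bounded sets; the premise
  \<open>bounded E\<close> below encodes that an unbounded set has infinite diameter.\<close>

definition regular_set :: "real \<Rightarrow> real \<Rightarrow> real \<Rightarrow> 'a::euclidean_space set \<Rightarrow> bool" where
  "regular_set Q \<alpha> \<beta> E \<longleftrightarrow>
     0 < Q \<and> Q < real DIM('a) \<and> 0 < \<alpha> \<and> \<alpha> \<le> \<beta> \<and>
     (\<exists>\<mu>. borel_regular_outer_measure \<mu> \<and> is_spt \<mu> E \<and>
        (\<forall>x\<in>E. \<forall>r>0. (bounded E \<longrightarrow> r < diameter E) \<longrightarrow>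
           ennreal (\<alpha> * r powr Q) \<le> \<mu> (ball x r) \<and>
           \<mu> (ball x r) \<le> ennreal (\<beta> * r powr Q)))"

section \<open>Rectifiable curves and line integrals\<close>

definition curve_length :: "(real \<Rightarrow> 'a::metric_space) \<Rightarrow> real \<Rightarrow> real \<Rightarrow> ennreal" where
  "curve_length g a b =
     (SUP (N, t) \<in> {(N::nat, t::nat \<Rightarrow> real). mono_on {..N} t \<and> t ` {..N} \<subseteq> {a..b}}.
        \<Sum>i<N. ennreal (dist (g (t i)) (g (t (Suc i)))))"

definition rectifiable_path :: "(real \<Rightarrow> 'a::metric_space) \<Rightarrow> bool" where
  "rectifiable_path g \<longleftrightarrow> path g \<and> curve_length g 0 1 < \<infinity>"

text \<open>Parametrization of a rectifiable path by arc length, on the interval from \<open>0\<close> to its total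
  length. The path is constant on the set of all \<open>t\<close> with the same value of
  \<open>curve_length g 0 t\<close>, so the choice of \<open>t\<close> is immaterial.\<close>

definition arc_length_param :: "(real \<Rightarrow> 'a::metric_space) \<Rightarrow> real \<Rightarrow> 'a" where
  "arc_length_param g u = g (SOME t. t \<in> {0..1} \<and> curve_length g 0 t = ennreal u)"

text \<open>The integral of a nonnegative density \<open>\<rho>\<close> with respect to arc length \<open>|dz|\<close>.\<close>

definition line_integral :: "('a::metric_space \<Rightarrow> real) \<Rightarrow> (real \<Rightarrow> 'a) \<Rightarrow> ennreal" where
  "line_integral \<rho> g =
     (\<integral>\<^sup>+u\<in>{0..enn2real (curve_length g 0 1)}. ennreal (\<rho> (arc_length_param g u)) \<partial>lborel)"

section \<open>Quasihyperbolic metric and volume\<close>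

definition proper_subdomain :: "'a::euclidean_space set \<Rightarrow> bool" where
  "proper_subdomain G \<longleftrightarrow> open G \<and> connected G \<and> G \<noteq> {} \<and> G \<noteq> UNIV"

definition bdist :: "'a::euclidean_space set \<Rightarrow> 'a \<Rightarrow> real" where
  "bdist G z = infdist z (frontier G)"

definition qh_dist :: "'a::euclidean_space set \<Rightarrow> 'a \<Rightarrow> 'a \<Rightarrow> ennreal" where
  "qh_dist G x y =
     (INF g \<in> {g. rectifiable_path g \<and> path_image g \<subseteq> G \<and> pathstart g = x \<and> pathfinish g = y}.
        line_integral (\<lambda>z. 1 / bdist G z) g)"

definition qh_ball :: "'a::euclidean_space set \<Rightarrow> 'a \<Rightarrow> real \<Rightarrow> 'a set" where
  "qh_ball G x r = {z \<in> G. qh_dist G x z < ennreal r}"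

definition qh_volume :: "'a::euclidean_space set \<Rightarrow> 'a set \<Rightarrow> ennreal" where
  "qh_volume G A = (\<integral>\<^sup>+z\<in>A. ennreal (1 / bdist G z ^ DIM('a)) \<partial>lebesgue)"

end

theory Submission
  imports Defs "HOL-Real_Asymp.Real_Asymp"
begin

text \<open>Along a curve parametrized by arc length the distance to the boundary is 1-Lipschitz, so
  \<open>k(x, z) \<ge> \<bar>ln (d(z) / d(x))\<bar>\<close>, and the quasihyperbolic ball of radius \<open>r\<close> lies in the
  region \<open>d(x) e\<^sup>-\<^sup>r \<le> d(z) \<le> d(x) e\<^sup>r\<close>. A maximal \<open>t\<close>-separated subset of the boundary has at most
  a constant times \<open>t powr (- Q) + 1\<close> points, by disjointness of the balls of radius \<open>t/2\<close>; hence
  the \<open>t\<close>-neighbourhood of the boundary has volume at most a constant times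
  \<open>t ^ n * (t powr (- Q) + 1)\<close>. Cutting the region into about \<open>2r\<close> shells on which \<open>d\<close> varies by a
  factor \<open>e\<close>, the first term sums to a geometric series of size \<open>e powr (Q r)\<close> and the second
  one contributes only \<open>O(r)\<close>.\<close>

section \<open>Arc length\<close>

lemma curve_length_ge:
  assumes "mono_on {..N} t" "t ` {..N} \<subseteq> {a..b}"
  shows "(\<Sum>i<N. ennreal (dist (g (t i)) (g (t (Suc i))))) \<le> curve_length g a b"
  unfolding curve_length_def using assms by (intro SUP_upper2[of "(N, t)"]) auto

lemma curve_length_le:
  assumes "\<And>N t. mono_on {..N} t \<Longrightarrow> t ` {..N} \<subseteq> {a..b} \<Longrightarrow>
    (\<Sum>i<N. ennreal (dist (g (t i)) (g (t (Suc i))))) \<le> K"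
  shows "curve_length g a b \<le> K"
  unfolding curve_length_def using assms by (intro SUP_least) auto

lemma dist_le_curve_length:
  assumes "a \<le> u" "u \<le> v" "v \<le> b"
  shows "ennreal (dist (g u) (g v)) \<le> curve_length g a b"
proof -
  let ?t = "\<lambda>i::nat. if i = 0 then u else v"
  have "mono_on {..1} ?t" "?t ` {..1} \<subseteq> {a..b}" using assms by (auto simp: mono_on_def)
  from curve_length_ge[OF this, of g] show ?thesis by simp
qed

lemma curve_length_degenerate: "curve_length g a a = 0"
proof -
  have "(\<Sum>i<N. ennreal (dist (g (t i)) (g (t (Suc i))))) = 0" if "t ` {..N} \<subseteq> {a..a}" for N t
  proof -
    have "t i = a" if "i \<le> N" for i using \<open>t ` {..N} \<subseteq> {a..a}\<close> that by auto
    then show ?thesis by simp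
  qed
  then have "curve_length g a a \<le> 0" by (intro curve_length_le) auto
  then show ?thesis by simp
qed

text \<open>Clamping keeps the number of partition points, so a polygonal sum can be split at
  \<open>c\<close> term by term, and the clamped sum can be regarded as a function of
  \<open>c\<close>.\<close>

lemma clamp_min:
  fixes t :: "nat \<Rightarrow> real"
  assumes "mono_on {..N} t" "t ` {..N} \<subseteq> {a..b}" "a \<le> c"
  shows "mono_on {..N} (\<lambda>i. min (t i) c)" "(\<lambda>i. min (t i) c) ` {..N} \<subseteq> {a..c}"
proof -
  show "mono_on {..N} (\<lambda>i. min (t i) c)"
    using mono_onD[OF assms(1)] by (intro mono_onI min.mono) auto
  show "(\<lambda>i. min (t i) c) ` {..N} \<subseteq> {a..c}"
    using assms(2,3) by (auto simp: image_subset_iff)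
qed

lemma clamp_max:
  fixes t :: "nat \<Rightarrow> real"
  assumes "mono_on {..N} t" "t ` {..N} \<subseteq> {a..b}" "c \<le> b"
  shows "mono_on {..N} (\<lambda>i. max (t i) c)" "(\<lambda>i. max (t i) c) ` {..N} \<subseteq> {c..b}"
proof -
  show "mono_on {..N} (\<lambda>i. max (t i) c)"
    using mono_onD[OF assms(1)] by (intro mono_onI max.mono) auto
  show "(\<lambda>i. max (t i) c) ` {..N} \<subseteq> {c..b}"
    using assms(2,3) by (auto simp: image_subset_iff)
qed

text \<open>If \<open>c\<close> lies between two consecutive partition points, the triangle
  inequality splits their distance at \<open>g c\<close>; otherwise one of the two clamped terms is
  zero and the other is the original one.\<close>

lemma curve_length_subadditive:
  fixes g :: "real \<Rightarrow> 'a::metric_space"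
  assumes "a \<le> c" "c \<le> b"
  shows "curve_length g a b \<le> curve_length g a c + curve_length g c b"
proof (rule curve_length_le)
  fix N and t :: "nat \<Rightarrow> real"
  assume t: "mono_on {..N} t" "t ` {..N} \<subseteq> {a..b}"
  have step: "ennreal (dist (g (t i)) (g (t (Suc i)))) \<le>
      ennreal (dist (g (min (t i) c)) (g (min (t (Suc i)) c))) +
      ennreal (dist (g (max (t i) c)) (g (max (t (Suc i)) c)))" if "i < N" for i
  proof -
    have "t i \<le> t (Suc i)" using t(1) that by (auto simp: mono_on_def)
    then have "dist (g (t i)) (g (t (Suc i))) \<le> dist (g (min (t i) c)) (g (min (t (Suc i)) c)) +
      dist (g (max (t i) c)) (g (max (t (Suc i)) c))"
      by (auto simp: min_def max_def dist_triangle)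
    then show ?thesis by (simp flip: ennreal_plus)
  qed
  have "(\<Sum>i<N. ennreal (dist (g (t i)) (g (t (Suc i))))) \<le>
      (\<Sum>i<N. ennreal (dist (g (min (t i) c)) (g (min (t (Suc i)) c)))) +
      (\<Sum>i<N. ennreal (dist (g (max (t i) c)) (g (max (t (Suc i)) c))))"
    unfolding sum.distrib[symmetric] using step by (intro sum_mono) auto
  also have "\<dots> \<le> curve_length g a c + curve_length g c b"
    by (intro add_mono curve_length_ge[OF clamp_min[OF t assms(1)]]
          curve_length_ge[OF clamp_max[OF t assms(2)]])
  finally show "(\<Sum>i<N. ennreal (dist (g (t i)) (g (t (Suc i))))) \<le> curve_length g a c + curve_length g c b" .
qed

text \<open>A partition of the left interval followed by one of the right interval is a partition of
  the whole; the suprema over the two are then taken independently.\<close>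

lemma curve_length_superadditive:
  fixes g :: "real \<Rightarrow> 'a::metric_space"
  assumes "a \<le> c" "c \<le> b"
  shows "curve_length g a c + curve_length g c b \<le> curve_length g a b"
proof -
  let ?P = "\<lambda>a b. {(N::nat, t::nat \<Rightarrow> real). mono_on {..N} t \<and> t ` {..N} \<subseteq> {a..b}}"
  let ?S = "\<lambda>(N, t). \<Sum>i<N. ennreal (dist (g (t i)) (g (t (Suc i))))"
  have ne: "?P a b \<noteq> {}" if "a \<le> b" for a b
    using that by (auto simp: mono_on_def intro!: exI[of _ 0] exI[of _ "\<lambda>_. a"])
  have "?S p + ?S q \<le> curve_length g a b" if "p \<in> ?P a c" "q \<in> ?P c b" for p q
  proof -
    obtain N t M s where [simp]: "p = (N, t)" "q = (M, s)" by fastforce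
    have t: "mono_on {..N} t" "t ` {..N} \<subseteq> {a..c}" and s: "mono_on {..M} s" "s ` {..M} \<subseteq> {c..b}"
      using that by auto
    define w where "w i = (if i \<le> N then t i else s (i - Suc N))" for i
    have tw: "a \<le> t i" "t i \<le> c" if "i \<le> N" for i using t(2) that by auto
    have sw: "c \<le> s i" "s i \<le> b" if "i \<le> M" for i using s(2) that by auto
    have "w i \<le> w j" if "i \<le> j" "j \<le> Suc N + M" for i j
    proof -
      consider "j \<le> N" | "i \<le> N" "\<not> j \<le> N" | "\<not> i \<le> N" by linarith
      then show ?thesis
      proof cases
        case 1 then show ?thesis using that t(1) by (auto simp: w_def mono_on_def)
      next
        case 2
        then have "j - Suc N \<le> M" using that by linarith
        then show ?thesis using 2 tw[of i] sw[of "j - Suc N"] by (auto simp: w_def)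
      next
        case 3
        then have "i - Suc N \<le> j - Suc N" "j - Suc N \<in> {..M}" "i - Suc N \<in> {..M}" using that by auto
        then show ?thesis using 3 that mono_onD[OF s(1)] by (auto simp: w_def)
      qed
    qed
    then have m: "mono_on {..Suc N + M} w" by (auto simp: mono_on_def)
    have r: "w ` {..Suc N + M} \<subseteq> {a..b}"
    proof (rule image_subsetI)
      fix i assume "i \<in> {..Suc N + M}"
      then have "\<not> i \<le> N \<Longrightarrow> i - Suc N \<le> M" by auto
      then show "w i \<in> {a..b}" using tw[of i] sw[of "i - Suc N"] assms by (auto simp: w_def)
    qed
    let ?d = "\<lambda>i. ennreal (dist (g (w i)) (g (w (Suc i))))"
    \<comment> \<open>Index \<open>N\<close> of \<open>w\<close>, the jump from \<open>t N\<close>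
      to \<open>s 0\<close>, does not occur here; its nonnegative term enters only with the
      enlargement to \<open>{..<Suc N + M}\<close>.\<close>
    have "?S p + ?S q = (\<Sum>i<N. ?d i) + (\<Sum>i<M. ?d (Suc N + i))"
      by (auto simp: w_def intro!: arg_cong2[where f = "(+)"] sum.cong)
    also have "\<dots> = sum ?d ({..<N} \<union> {Suc N..<Suc N + M})"
      using sum.shift_bounds_nat_ivl[of ?d 0 "Suc N" M]
      by (subst sum.union_disjoint) (auto simp: atLeast0LessThan add.commute)
    also have "\<dots> \<le> sum ?d {..<Suc N + M}"
      by (rule sum_mono2) auto
    also have "\<dots> \<le> curve_length g a b" by (rule curve_length_ge[OF m r])
    finally show ?thesis .
  qed
  then have "(SUP q\<in>?P c b. SUP p\<in>?P a c. ?S p + ?S q) \<le> curve_length g a b"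
    by (intro SUP_least)
  \<comment> \<open>Suprema move out of a sum in \<open>ennreal\<close> over nonempty index sets,
    which \<open>ne\<close> provides.\<close>
  moreover have "curve_length g a c + curve_length g c b = (SUP q\<in>?P c b. SUP p\<in>?P a c. ?S p + ?S q)"
    unfolding curve_length_def
    by (simp only: ennreal_SUP_add_left[OF ne[OF assms(1)], symmetric]
          ennreal_SUP_add_right[OF ne[OF assms(2)]])
  ultimately show ?thesis by simp
qed

text \<open>Clamping the partition points at \<open>c\<close> writes the length as a supremum of functions
  that are continuous in \<open>c\<close>; this gives lower semicontinuity.\<close>

lemma closed_curve_length_initial_le:
  fixes g :: "real \<Rightarrow> 'a::metric_space"
  assumes g: "continuous_on {a..b} g" and "0 \<le> u"
  shows "closed {c \<in> {a..b}. curve_length g a c \<le> ennreal u}"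
proof -
  let ?P = "{(N::nat, t::nat \<Rightarrow> real). mono_on {..N} t \<and> t ` {..N} \<subseteq> {a..b}}"
  let ?S = "\<lambda>(N, t) c. \<Sum>i<N. dist (g (min (t i) c)) (g (min (t (Suc i)) c))"
  have le: "ennreal (?S (N, t) c) \<le> curve_length g a c"
    if "(N, t) \<in> ?P" "c \<in> {a..b}" for N t c
    using curve_length_ge[OF clamp_min[of N t a b c], of g] that by (auto simp: sum_ennreal)
  have "curve_length g a c \<le> ennreal u" if "\<forall>p\<in>?P. ?S p c \<le> u" "c \<in> {a..b}" for c
  proof (rule curve_length_le)
    fix N and t :: "nat \<Rightarrow> real"
    assume t: "mono_on {..N} t" "t ` {..N} \<subseteq> {a..c}"
    \<comment> \<open>A partition of \<open>{a..c}\<close> is also one of \<open>{a..b}\<close> and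
      is fixed by clamping at \<open>c\<close>, so the clamped sums over \<open>?P\<close> already
      see every polygonal sum of the initial piece.\<close>
    then have "(N, t) \<in> ?P" using that(2) by fastforce
    then have "?S (N, t) c \<le> u" using that(1) by blast
    moreover have "min (t i) c = t i" if "i \<le> N" for i using t(2) that by (auto simp: min_def)
    ultimately show "(\<Sum>i<N. ennreal (dist (g (t i)) (g (t (Suc i))))) \<le> ennreal u"
      by (simp add: sum_ennreal ennreal_leI)
  qed
  moreover have "?S p c \<le> u" if "curve_length g a c \<le> ennreal u" "p \<in> ?P" "c \<in> {a..b}" for p c
  proof -
    obtain N t where p: "p = (N, t)" by fastforce
    have "ennreal (?S p c) \<le> ennreal u"
      using order_trans[OF le[of N t c] that(1)] that(2,3) unfolding p by blast
    then show ?thesis using assms(2) by (simp only: ennreal_le_iff)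
  qed
  ultimately have "{c \<in> {a..b}. curve_length g a c \<le> ennreal u} =
      {a..b} \<inter> (\<Inter>p\<in>?P. {c \<in> {a..b}. ?S p c \<le> u})"
    by blast
  moreover have "closed {c \<in> {a..b}. ?S p c \<le> u}" if "p \<in> ?P" for p
  proof (rule continuous_on_closed_Collect_le)
    obtain N t where p: "p = (N, t)" by fastforce
    have "t i \<in> {a..b}" if "i \<le> N" for i using \<open>p \<in> ?P\<close> p that by auto
    then show "continuous_on {a..b} (?S p)"
      unfolding p prod.case
      by (intro continuous_intros continuous_on_compose2[OF g])
         (auto simp: min_le_iff_disj)
  qed auto
  ultimately show ?thesis by (simp only:) (intro closed_Int closed_INT closed_atLeastAtMost ballI)
qed

text \<open>Mirror image of the preceding argument, clamping from below with \<open>max\<close>.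
  Together the two closed sets replace a proof that arc length is continuous.\<close>

lemma closed_curve_length_final_le:
  fixes g :: "real \<Rightarrow> 'a::metric_space"
  assumes g: "continuous_on {a..b} g" and "0 \<le> u"
  shows "closed {c \<in> {a..b}. curve_length g c b \<le> ennreal u}"
proof -
  let ?P = "{(N::nat, t::nat \<Rightarrow> real). mono_on {..N} t \<and> t ` {..N} \<subseteq> {a..b}}"
  let ?S = "\<lambda>(N, t) c. \<Sum>i<N. dist (g (max (t i) c)) (g (max (t (Suc i)) c))"
  have le: "ennreal (?S (N, t) c) \<le> curve_length g c b"
    if "(N, t) \<in> ?P" "c \<in> {a..b}" for N t c
    using curve_length_ge[OF clamp_max[of N t a b c], of g] that by (auto simp: sum_ennreal)
  have "curve_length g c b \<le> ennreal u" if "\<forall>p\<in>?P. ?S p c \<le> u" "c \<in> {a..b}" for c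
  proof (rule curve_length_le)
    fix N and t :: "nat \<Rightarrow> real"
    assume t: "mono_on {..N} t" "t ` {..N} \<subseteq> {c..b}"
    then have "(N, t) \<in> ?P" using that(2) by fastforce
    then have "?S (N, t) c \<le> u" using that(1) by blast
    moreover have "max (t i) c = t i" if "i \<le> N" for i using t(2) that by (auto simp: max_def)
    ultimately show "(\<Sum>i<N. ennreal (dist (g (t i)) (g (t (Suc i))))) \<le> ennreal u"
      by (simp add: sum_ennreal ennreal_leI)
  qed
  moreover have "?S p c \<le> u" if "curve_length g c b \<le> ennreal u" "p \<in> ?P" "c \<in> {a..b}" for p c
  proof -
    obtain N t where p: "p = (N, t)" by fastforce
    have "ennreal (?S p c) \<le> ennreal u"
      using order_trans[OF le[of N t c] that(1)] that(2,3) unfolding p by blast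
    then show ?thesis using assms(2) by (simp only: ennreal_le_iff)
  qed
  ultimately have "{c \<in> {a..b}. curve_length g c b \<le> ennreal u} =
      {a..b} \<inter> (\<Inter>p\<in>?P. {c \<in> {a..b}. ?S p c \<le> u})"
    by blast
  moreover have "closed {c \<in> {a..b}. ?S p c \<le> u}" if "p \<in> ?P" for p
  proof (rule continuous_on_closed_Collect_le)
    obtain N t where p: "p = (N, t)" by fastforce
    have "t i \<in> {a..b}" if "i \<le> N" for i using \<open>p \<in> ?P\<close> p that by auto
    then show "continuous_on {a..b} (?S p)"
      unfolding p prod.case
      by (intro continuous_intros continuous_on_compose2[OF g])
         (auto simp: le_max_iff_disj)
  qed auto
  ultimately show ?thesis by (simp only:) (intro closed_Int closed_INT closed_atLeastAtMost ballI)
qed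

text \<open>By superadditivity the closed sets \<open>A\<close> and \<open>B\<close> cover the
  connected interval \<open>{a..b}\<close>, so they meet; at a common point subadditivity forces the
  initial length to be exactly \<open>u\<close>.\<close>

lemma curve_length_attains:
  fixes g :: "real \<Rightarrow> 'a::metric_space"
  assumes g: "continuous_on {a..b} g" "a \<le> b"
    and L: "curve_length g a b = ennreal L" and u: "0 \<le> u" "u \<le> L"
  shows "\<exists>c\<in>{a..b}. curve_length g a c = ennreal u"
proof -
  define A where "A = {c \<in> {a..b}. curve_length g a c \<le> ennreal u}"
  define B where "B = {c \<in> {a..b}. curve_length g c b \<le> ennreal (L - u)}"
  have "c \<in> B" if c: "c \<in> {a..b}" "c \<notin> A" for c
  proof -
    have "curve_length g a c + curve_length g c b \<le> ennreal L"
      using curve_length_superadditive[of a c b g] c L by simp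
    moreover have "ennreal u \<le> curve_length g a c" using c by (simp add: A_def)
    ultimately have "ennreal u + curve_length g c b \<le> ennreal L"
      by (meson add_right_mono order_trans)
    \<comment> \<open>Cancelling \<open>u\<close> in \<open>ennreal\<close> requires the remaining
      length to be finite.\<close>
    moreover have "curve_length g c b \<noteq> \<infinity>"
      using calculation ennreal_less_top[of L] by (auto simp: top_unique)
    ultimately show ?thesis using c(1) u unfolding B_def
      by (cases "curve_length g c b") (auto simp flip: ennreal_plus simp: ennreal_le_iff)
  qed
  then have "{a..b} \<subseteq> A \<union> B" by blast
  moreover have "closed A" "closed B"
    using closed_curve_length_initial_le[OF g(1)] closed_curve_length_final_le[OF g(1)] u by (auto simp: A_def B_def)
  moreover have "a \<in> A \<inter> {a..b}" "b \<in> B \<inter> {a..b}"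
    using g(2) by (auto simp: A_def B_def curve_length_degenerate)
  ultimately have "A \<inter> B \<noteq> {}"
    using connected_closedD[of "{a..b}" A B] connected_Icc by blast
  then obtain c where c: "c \<in> {a..b}" "curve_length g a c \<le> ennreal u" "curve_length g c b \<le> ennreal (L - u)"
    by (auto simp: A_def B_def)
  have "ennreal L \<le> curve_length g a c + ennreal (L - u)"
    using curve_length_subadditive[of a c b g] c L by (auto intro: order_trans add_left_mono)
  then have "ennreal u \<le> curve_length g a c"
    using c u by (cases "curve_length g a c") (auto simp flip: ennreal_plus simp: ennreal_le_iff)
  then show ?thesis using c by auto
qed

text \<open>The selected parameter cuts the curve into an initial piece of length \<open>u\<close>
  and a final piece of length at most \<open>L - u\<close>; chords are no longer than arcs.\<close>

lemma arc_length_param_dist: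
  fixes g :: "real \<Rightarrow> 'a::metric_space"
  assumes g: "path g" and L: "curve_length g 0 1 = ennreal L" and u: "0 \<le> u" "u \<le> L"
  shows "dist (pathstart g) (arc_length_param g u) \<le> u"
    and "dist (arc_length_param g u) (pathfinish g) \<le> L - u"
    and "arc_length_param g u \<in> path_image g"
proof -
  define c where "c = (SOME t. t \<in> {0..1} \<and> curve_length g 0 t = ennreal u)"
  \<comment> \<open>Every length in \<open>{0..L}\<close> is attained, so the choice in
    \<open>arc_length_param\<close> meets its defining condition.\<close>
  have "\<exists>t. t \<in> {0..1} \<and> curve_length g 0 t = ennreal u"
    using curve_length_attains[OF _ _ L u] g by (auto simp: path_def)
  then have "c \<in> {0..1} \<and> curve_length g 0 c = ennreal u"
    unfolding c_def by (rule someI_ex)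
  then have c: "c \<in> {0..1}" "curve_length g 0 c = ennreal u" by auto
  have p: "arc_length_param g u = g c" by (simp add: arc_length_param_def c_def)
  show "arc_length_param g u \<in> path_image g" using c by (simp add: p path_image_def)
  show "dist (pathstart g) (arc_length_param g u) \<le> u"
    using dist_le_curve_length[of 0 0 c c g] c u by (simp add: p pathstart_def ennreal_le_iff)
  have "ennreal u + ennreal (dist (g c) (g 1)) \<le> ennreal L"
    using curve_length_superadditive[of 0 c 1 g] dist_le_curve_length[of c c 1 1 g] c L
    by (auto intro: order_trans add_left_mono)
  then show "dist (arc_length_param g u) (pathfinish g) \<le> L - u"
    using u by (simp add: p pathfinish_def ennreal_le_iff flip: ennreal_plus)
qed

section \<open>Comparison of distances to the boundary\<close>

text \<open>The logarithm is the integral of \<open>1 / (c + u)\<close>. The comparison is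
  pointwise, so it applies to any such \<open>f\<close>, measurable or not.\<close>

lemma ln_le_nn_integral_inverse_left:
  fixes f :: "real \<Rightarrow> real"
  assumes "0 < c" "0 \<le> L" and f: "\<And>u. u \<in> {0..L} \<Longrightarrow> 0 < f u \<and> f u \<le> c + u"
  shows "ennreal (ln ((c + L) / c)) \<le> (\<integral>\<^sup>+u\<in>{0..L}. ennreal (1 / f u) \<partial>lborel)"
proof -
  have "(\<integral>\<^sup>+u. ennreal (1 / (c + u)) * indicator {0..L} u \<partial>lborel) = ennreal (ln (c + L) - ln (c + 0))"
    using assms(1,2) by (intro nn_integral_FTC_Icc) (auto intro!: derivative_eq_intros)
  also have "ln (c + L) - ln (c + 0) = ln ((c + L) / c)"
    using assms(1,2) by (simp add: ln_div)
  finally have "ennreal (ln ((c + L) / c)) = (\<integral>\<^sup>+u. ennreal (1 / (c + u)) * indicator {0..L} u \<partial>lborel)" ..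
  also have "\<dots> \<le> (\<integral>\<^sup>+u. ennreal (1 / f u) * indicator {0..L} u \<partial>lborel)"
    using f by (intro nn_integral_mono) (auto simp: indicator_def intro!: ennreal_leI frac_le)
  finally show ?thesis .
qed

text \<open>Counterpart for curves read from their endpoint, with antiderivative
  \<open>- ln (c + (L - u))\<close>.\<close>

lemma ln_le_nn_integral_inverse_right:
  fixes f :: "real \<Rightarrow> real"
  assumes "0 < c" "0 \<le> L" and f: "\<And>u. u \<in> {0..L} \<Longrightarrow> 0 < f u \<and> f u \<le> c + (L - u)"
  shows "ennreal (ln ((c + L) / c)) \<le> (\<integral>\<^sup>+u\<in>{0..L}. ennreal (1 / f u) \<partial>lborel)"
proof -
  have "(\<integral>\<^sup>+u. ennreal (1 / (c + (L - u))) * indicator {0..L} u \<partial>lborel) =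
      ennreal (- ln (c + (L - L)) - - ln (c + (L - 0)))"
    using assms(1,2) by (intro nn_integral_FTC_Icc) (auto intro!: derivative_eq_intros)
  also have "- ln (c + (L - L)) - - ln (c + (L - 0)) = ln ((c + L) / c)"
    using assms(1,2) by (simp add: ln_div)
  finally have "ennreal (ln ((c + L) / c)) = (\<integral>\<^sup>+u. ennreal (1 / (c + (L - u))) * indicator {0..L} u \<partial>lborel)" ..
  also have "\<dots> \<le> (\<integral>\<^sup>+u. ennreal (1 / f u) * indicator {0..L} u \<partial>lborel)"
    using f by (intro nn_integral_mono) (auto simp: indicator_def intro!: ennreal_leI frac_le)
  finally show ?thesis .
qed

text \<open>By connectedness only the empty set and the whole space have empty frontier. This rules
  out the default value \<open>infdist z {} = 0\<close>.\<close>

lemma proper_subdomain_frontier_nonempty: "proper_subdomain G \<Longrightarrow> frontier G \<noteq> {}"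
  by (auto simp: proper_subdomain_def frontier_eq_empty)

lemma bdist_pos:
  assumes "proper_subdomain G" "z \<in> G"
  shows "0 < bdist G z"
proof -
  have "z \<notin> frontier G" using assms by (auto simp: proper_subdomain_def frontier_def interior_open)
  then show ?thesis
    using infdist_pos_not_in_closed[OF frontier_closed proper_subdomain_frontier_nonempty[OF assms(1)]]
    by (simp add: bdist_def)
qed

lemma bdist_le_add_dist: "bdist G y \<le> bdist G z + dist y z"
  unfolding bdist_def by (rule infdist_triangle)

text \<open>On a curve of quasihyperbolic length below \<open>r\<close> and Euclidean length
  \<open>L\<close>, \<open>bdist G\<close> is at most \<open>bdist G x + u\<close> after arc length
  \<open>u\<close>. Hence \<open>ln ((bdist G x + L) / bdist G x) < r\<close>, while
  \<open>bdist G z \<le> bdist G x + L\<close>. The lower bound is the same argument read from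
  \<open>z\<close>.\<close>

lemma qh_dist_imp_bdist_bounds:
  assumes G: "proper_subdomain G" and xz: "x \<in> G" "z \<in> G" and r: "qh_dist G x z < ennreal r"
  shows "bdist G x * exp (- r) \<le> bdist G z" and "bdist G z \<le> bdist G x * exp r"
proof -
  obtain g where g: "path g" "curve_length g 0 1 < \<infinity>" "path_image g \<subseteq> G" "pathstart g = x" "pathfinish g = z"
    and gr: "line_integral (\<lambda>z. 1 / bdist G z) g < ennreal r"
    using r unfolding qh_dist_def INF_less_iff by (auto simp: rectifiable_path_def)
  define L where "L = enn2real (curve_length g 0 1)"
  have L: "curve_length g 0 1 = ennreal L" "0 \<le> L" using g(2) by (auto simp: L_def)
  let ?f = "\<lambda>u. bdist G (arc_length_param g u)"
  have pos: "0 < bdist G x" "0 < bdist G z" using bdist_pos[OF G] xz by auto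
  have f: "0 < ?f u" "?f u \<le> bdist G x + u" "?f u \<le> bdist G z + (L - u)"
    "bdist G z \<le> ?f u + (L - u)" "bdist G x \<le> ?f u + u"
    if "u \<in> {0..L}" for u
    using arc_length_param_dist[OF g(1) L(1), of u] that g bdist_pos[OF G, of "arc_length_param g u"]
      bdist_le_add_dist[of G "arc_length_param g u" x] bdist_le_add_dist[of G "arc_length_param g u" z]
      bdist_le_add_dist[of G x "arc_length_param g u"] bdist_le_add_dist[of G z "arc_length_param g u"]
    by (auto simp: dist_commute)
  have gr: "(\<integral>\<^sup>+u\<in>{0..L}. ennreal (1 / ?f u) \<partial>lborel) < ennreal r"
    using gr by (simp add: line_integral_def L_def)
  \<comment> \<open>To be applied with \<open>c = bdist G x\<close> and
    \<open>c = bdist G z\<close>. The logarithm is nonnegative because \<open>0 \<le> L\<close>, so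
    the strict inequality passes from \<open>ennreal\<close> to the reals.\<close>
  have less: "c + L < c * exp r"
    if "0 < c" "ennreal (ln ((c + L) / c)) \<le> (\<integral>\<^sup>+u\<in>{0..L}. ennreal (1 / ?f u) \<partial>lborel)" for c
  proof -
    have "ennreal (ln ((c + L) / c)) < ennreal r" using that(2) gr by (rule le_less_trans)
    then have "ln ((c + L) / c) < r"
      using that(1) L(2) by (subst (asm) ennreal_less_iff) auto
    then have "(c + L) / c < exp r"
      using that(1) L(2) by (metis add_pos_nonneg divide_pos_pos exp_less_mono exp_ln)
    then show ?thesis using that(1) by (simp add: field_simps)
  qed
  have "bdist G x + L < bdist G x * exp r"
    using pos L(2) f by (intro less ln_le_nn_integral_inverse_left) auto
  moreover have "bdist G z \<le> bdist G x + L" using f(2)[of L] f(4)[of L] L(2) by auto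
  ultimately show "bdist G z \<le> bdist G x * exp r" by simp
  have "bdist G z + L < bdist G z * exp r"
    using pos L(2) f by (intro less ln_le_nn_integral_inverse_right) auto
  moreover have "bdist G x \<le> bdist G z + L" using f(3)[of 0] f(5)[of 0] L(2) by auto
  ultimately have "bdist G x \<le> bdist G z * exp r" by simp
  then show "bdist G x * exp (- r) \<le> bdist G z" by (simp add: exp_minus field_simps)
qed

section \<open>Packing and neighbourhoods of regular sets\<close>

text \<open>Balls of half the separation are disjoint, so their masses add up. The measure is left
  general to serve both Lebesgue measure and the measure carried by a regular set.\<close>

lemma separated_card_times_le_emeasure:
  fixes S :: "'a::metric_space set"
  assumes M: "sets M = sets borel" and S: "finite S" "pairwise (\<lambda>x y. \<epsilon> \<le> dist x y) S"
    and c: "\<And>s. s \<in> S \<Longrightarrow> c \<le> emeasure M (ball s (\<epsilon> / 2))"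
    and B: "B \<in> sets M" "(\<Union>s\<in>S. ball s (\<epsilon> / 2)) \<subseteq> B"
  shows "of_nat (card S) * c \<le> emeasure M B"
proof -
  have "disjoint_family_on (\<lambda>s. ball s (\<epsilon> / 2)) S"
    unfolding disjoint_family_on_def
  proof (intro ballI impI)
    fix x y assume "x \<in> S" "y \<in> S" "x \<noteq> y"
    then have "\<epsilon> \<le> dist x y" using S(2) by (auto simp: pairwise_def)
    then have False if "z \<in> ball x (\<epsilon> / 2)" "z \<in> ball y (\<epsilon> / 2)" for z
      using that dist_triangle2[of x y z] by simp
    then show "ball x (\<epsilon> / 2) \<inter> ball y (\<epsilon> / 2) = {}" by blast
  qed
  then have "(\<Sum>s\<in>S. emeasure M (ball s (\<epsilon> / 2))) = emeasure M (\<Union>s\<in>S. ball s (\<epsilon> / 2))"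
    using S(1) by (intro sum_emeasure) (auto simp: M)
  also have "\<dots> \<le> emeasure M B" using B by (intro emeasure_mono) auto
  finally have "(\<Sum>s\<in>S. emeasure M (ball s (\<epsilon> / 2))) \<le> emeasure M B" .
  moreover have "of_nat (card S) * c \<le> (\<Sum>s\<in>S. emeasure M (ball s (\<epsilon> / 2)))"
    using c by (intro sum_bounded_below) auto
  ultimately show ?thesis by simp
qed

text \<open>Volume comparison: the disjoint balls of radius \<open>\<epsilon> / 2\<close> lie in one
  ball of radius \<open>R + \<epsilon> / 2\<close>, and the volume of the unit ball cancels.\<close>

lemma separated_card_le:
  fixes S :: "'a::euclidean_space set"
  assumes S: "finite S" "S \<subseteq> cball p R" "pairwise (\<lambda>x y. \<epsilon> \<le> dist x y) S" and "0 < \<epsilon>" "0 \<le> R"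
  shows "real (card S) * (\<epsilon> / 2) ^ DIM('a) \<le> (R + \<epsilon> / 2) ^ DIM('a)"
proof -
  let ?v = "unit_ball_vol (real DIM('a))"
  have v: "0 < ?v" by simp
  have sub: "(\<Union>s\<in>S. ball s (\<epsilon> / 2)) \<subseteq> cball p (R + \<epsilon> / 2)"
  proof safe
    fix s z assume "s \<in> S" "z \<in> ball s (\<epsilon> / 2)"
    then show "z \<in> cball p (R + \<epsilon> / 2)" using S(2) dist_triangle[of p z s] by auto
  qed
  have "of_nat (card S) * ennreal (?v * (\<epsilon> / 2) ^ DIM('a)) \<le> emeasure lborel (cball p (R + \<epsilon> / 2))"
    using assms sub
    by (intro separated_card_times_le_emeasure[where \<epsilon> = \<epsilon> and S = S])
       (auto simp: emeasure_ball)
  also have "\<dots> = ennreal (?v * (R + \<epsilon> / 2) ^ DIM('a))"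
    using assms by (simp add: emeasure_cball)
  finally have "ennreal (real (card S) * (?v * (\<epsilon> / 2) ^ DIM('a))) \<le> ennreal (?v * (R + \<epsilon> / 2) ^ DIM('a))"
    using assms by (simp add: ennreal_mult ennreal_of_nat_eq_real_of_nat)
  then have "real (card S) * (?v * (\<epsilon> / 2) ^ DIM('a)) \<le> ?v * (R + \<epsilon> / 2) ^ DIM('a)"
    using assms v by (subst (asm) ennreal_le_iff) auto
  then have "?v * (real (card S) * (\<epsilon> / 2) ^ DIM('a)) \<le> ?v * (R + \<epsilon> / 2) ^ DIM('a)"
    by (simp only: mult.left_commute)
  then show ?thesis using v by (simp only: mult_le_cancel_left_pos)
qed

text \<open>Packing in a large ball bounds the size of separated subsets, so one of greatest
  cardinality exists; a point of \<open>E\<close> missed by its balls could be added to it.\<close>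

lemma finite_separated_net:
  fixes E :: "'a::euclidean_space set"
  assumes "bounded E" "0 < \<epsilon>"
  obtains S where "finite S" "S \<subseteq> E" "pairwise (\<lambda>x y. \<epsilon> \<le> dist x y) S" "E \<subseteq> (\<Union>s\<in>S. ball s \<epsilon>)"
proof -
  let ?P = "\<lambda>S. finite S \<and> S \<subseteq> E \<and> pairwise (\<lambda>x y. \<epsilon> \<le> dist x y) S"
  obtain R where R: "0 < R" "E \<subseteq> cball 0 R"
    using assms(1) by (metis bounded_subset_ballD subset_trans ball_subset_cball)
  define b where "b = (R + \<epsilon> / 2) ^ DIM('a) / (\<epsilon> / 2) ^ DIM('a)"
  have "card S < Suc (nat \<lceil>b\<rceil>)" if "?P S" for S
  proof -
    have "real (card S) \<le> b"
      using separated_card_le[of S 0 R \<epsilon>] that R assms(2) by (auto simp: b_def field_simps)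
    then show ?thesis by linarith
  qed
  then obtain S where S: "?P S" "\<And>T. ?P T \<Longrightarrow> card T \<le> card S"
    using ex_has_greatest_nat[of ?P "{}" card "Suc (nat \<lceil>b\<rceil>)"] by auto
  have "E \<subseteq> (\<Union>s\<in>S. ball s \<epsilon>)"
  proof (rule ccontr)
    assume "\<not> E \<subseteq> (\<Union>s\<in>S. ball s \<epsilon>)"
    then obtain e where "e \<in> E" "e \<notin> (\<Union>s\<in>S. ball s \<epsilon>)" by blast
    then have e: "e \<in> E" "\<And>s. s \<in> S \<Longrightarrow> \<epsilon> \<le> dist s e" by (auto simp: not_less)
    then have "e \<notin> S" using assms(2) by fastforce
    moreover have "?P (insert e S)"
      using S(1) e by (auto simp: pairwise_insert dist_commute)
    ultimately show False using S(2)[of "insert e S"] S(1) by simp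
  qed
  then show ?thesis using that S(1) by blast
qed

text \<open>Caratheodory's theorem makes \<open>\<mu>\<close> a measure on its
  \<open>lambda_system\<close>, which contains the Borel sets. Masses of disjoint balls can then be
  added.\<close>

lemma borel_regular_outer_measure_imp_measure:
  fixes \<mu> :: "'a::topological_space set \<Rightarrow> ennreal"
  assumes "borel_regular_outer_measure \<mu>"
  obtains M where "sets M = sets borel" "\<And>A. A \<in> sets borel \<Longrightarrow> emeasure M A = \<mu> A"
proof
  let ?M = "measure_of UNIV (sets borel) \<mu>"
  interpret sigma_algebra UNIV "UNIV :: 'a set set"
    using sigma_algebra_Pow[of "UNIV :: 'a set"] by simp
  have sb: "sigma_algebra UNIV (sets (borel :: 'a measure))"
    using sets.sigma_algebra_axioms[of "borel :: 'a measure"] by simp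
  have "measure_space UNIV (sets borel) \<mu>"
    using assms measure_down[OF caratheodory_lemma sb, of \<mu>]
    by (auto simp: borel_regular_outer_measure_def)
  then show "emeasure ?M A = \<mu> A" if "A \<in> sets borel" for A
    using that sb by (intro emeasure_measure_of_sigma) (auto simp: measure_space_def)
  show "sets ?M = sets borel"
    using sigma_algebra.sets_measure_of_eq[OF sb] by simp
qed

text \<open>The upper bound is available only for radii below the diameter, and a single such ball
  may miss part of \<open>E\<close>. A separated net of spacing \<open>diameter E / 2\<close> covers
  \<open>E\<close> by at most \<open>8 ^ DIM('a)\<close> admissible balls.\<close>

lemma regular_set_total_mass:
  fixes E :: "'a::euclidean_space set"
  assumes E: "compact E" "0 < diameter E" and "0 \<le> \<beta>"
    and M: "sets M = sets borel" "emeasure M (- E) = 0"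
    and upper: "\<And>x r. x \<in> E \<Longrightarrow> 0 < r \<Longrightarrow> r < diameter E \<Longrightarrow> emeasure M (ball x r) \<le> ennreal (\<beta> * r powr Q)"
  shows "emeasure M UNIV \<le> ennreal (8 ^ DIM('a) * (\<beta> * (diameter E / 2) powr Q))"
proof -
  let ?D = "diameter E"
  have "bounded E" using E(1) by (rule compact_imp_bounded)
  obtain S where S: "finite S" "S \<subseteq> E" "pairwise (\<lambda>x y. ?D / 2 \<le> dist x y) S"
      "E \<subseteq> (\<Union>s\<in>S. ball s (?D / 2))"
    using finite_separated_net[OF \<open>bounded E\<close>, of "?D / 2"] E(2) by auto
  have "E \<noteq> {}" using E(2) by (auto simp: diameter_def)
  then obtain p where p: "p \<in> E" by blast
  have "S \<subseteq> cball p ?D"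
    using S(2) diameter_bounded_bound[OF \<open>bounded E\<close> p] by auto
  then have "real (card S) * (?D / 2 / 2) ^ DIM('a) \<le> (?D + ?D / 2 / 2) ^ DIM('a)"
    using S E(2) by (intro separated_card_le) auto
  \<comment> \<open>The base on the left is \<open>5 * (?D / 4)\<close>; the factor 5 is rounded up
    to 8.\<close>
  also have "\<dots> \<le> (8 * (?D / 2 / 2)) ^ DIM('a)"
    using E(2) by (intro power_mono) auto
  also have "\<dots> = 8 ^ DIM('a) * (?D / 2 / 2) ^ DIM('a)" by (rule power_mult_distrib)
  finally have card: "real (card S) \<le> 8 ^ DIM('a)"
    by (rule mult_right_le_imp_le) (use E(2) in auto)
  have "closed E" using E(1) by (rule compact_imp_closed)
  have "emeasure M UNIV \<le> emeasure M ((\<Union>s\<in>S. ball s (?D / 2)) \<union> - E)"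
    using S(4) \<open>closed E\<close> by (intro emeasure_mono) (auto simp: M intro!: sets.finite_UN S(1))
  also have "\<dots> \<le> emeasure M (\<Union>s\<in>S. ball s (?D / 2)) + emeasure M (- E)"
    using \<open>closed E\<close> by (intro emeasure_subadditive) (auto simp: M intro!: S(1))
  also have "\<dots> \<le> (\<Sum>s\<in>S. emeasure M (ball s (?D / 2)))"
    unfolding M(2) add_0_right using S(1) by (intro emeasure_subadditive_finite) (auto simp: M)
  also have "\<dots> \<le> of_nat (card S) * ennreal (\<beta> * (?D / 2) powr Q)"
    using S(2) E(2) by (intro sum_bounded_above upper) auto
  also have "\<dots> = ennreal (real (card S) * (\<beta> * (?D / 2) powr Q))"
    using assms(3) by (simp add: ennreal_mult ennreal_of_nat_eq_real_of_nat)
  also have "\<dots> \<le> ennreal (8 ^ DIM('a) * (\<beta> * (?D / 2) powr Q))"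
    using card assms(3) by (intro ennreal_leI mult_right_mono) auto
  finally show ?thesis .
qed

text \<open>Balls of radius \<open>2 * t\<close> about a \<open>t\<close>-net of \<open>E\<close>
  cover the neighbourhood, and lower regularity bounds the size of the net by the total mass. The
  two summands \<open>+ 1\<close> let the same formula cover large \<open>t\<close>, where one ball
  suffices.\<close>

lemma regular_set_neighbourhood_volume:
  fixes E :: "'a::euclidean_space set"
  assumes reg: "regular_set Q \<alpha> \<beta> E" and E: "compact E" "E \<noteq> {}" and "0 < t"
  shows "emeasure lborel {z. infdist z E \<le> t} \<le>
    ennreal (unit_ball_vol DIM('a) * 16 ^ DIM('a) * (\<beta> / \<alpha> * diameter E powr Q + 1) *
      (t ^ DIM('a) * (t powr (- Q) + 1)))"
proof -
  let ?D = "diameter E" and ?n = "DIM('a)" and ?v = "unit_ball_vol (real DIM('a))"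
  have v: "0 < ?v" by simp
  have bE: "bounded E" and cE: "closed E" using E(1) by (simp_all add: compact_imp_bounded compact_imp_closed)
  have D0: "0 \<le> ?D" using bE by (rule diameter_ge_0)
  obtain \<mu> where ab: "0 < Q" "0 < \<alpha>" "\<alpha> \<le> \<beta>" and \<mu>: "borel_regular_outer_measure \<mu>" "is_spt \<mu> E"
    and \<mu>ball: "\<And>x r. x \<in> E \<Longrightarrow> 0 < r \<Longrightarrow> r < ?D \<Longrightarrow>
           ennreal (\<alpha> * r powr Q) \<le> \<mu> (ball x r) \<and> \<mu> (ball x r) \<le> ennreal (\<beta> * r powr Q)"
    using reg bE unfolding regular_set_def by metis
  \<comment> \<open>\<open>E\<close> is closed, so the distance is attained and radius
    \<open>2 * t\<close> suffices below without an error term.\<close>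
  have near: "\<exists>e\<in>E. dist z e \<le> t" if "infdist z E \<le> t" for z
    using infdist_attains_inf[OF cE E(2), of z] that by metis
  have main: "emeasure lborel {z. infdist z E \<le> t} \<le> ennreal (K * (?v * (2 * t) ^ ?n))"
    if S: "S \<subseteq> E" "finite S" "E \<subseteq> (\<Union>s\<in>S. cball s t)" "real (card S) \<le> K" for S K
  proof -
    have "{z. infdist z E \<le> t} \<subseteq> (\<Union>s\<in>S. cball s (2 * t))"
    proof safe
      fix z assume "infdist z E \<le> t"
      then obtain e where e: "e \<in> E" "dist z e \<le> t" using near by blast
      then obtain s where s: "s \<in> S" "dist s e \<le> t" using S(3) by auto
      then show "z \<in> (\<Union>s\<in>S. cball s (2 * t))" using e dist_triangle2[of s z e] by (force intro!: bexI[of _ s])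
    qed
    then have "emeasure lborel {z. infdist z E \<le> t} \<le> emeasure lborel (\<Union>s\<in>S. cball s (2 * t))"
      using S(2) by (intro emeasure_mono) auto
    also have "\<dots> \<le> (\<Sum>s\<in>S. emeasure lborel (cball s (2 * t)))"
      using S(2) by (intro emeasure_subadditive_finite) auto
    also have "\<dots> = ennreal (real (card S) * (?v * (2 * t) ^ ?n))"
      using \<open>0 < t\<close> by (simp add: emeasure_cball ennreal_mult ennreal_of_nat_eq_real_of_nat)
    also have "\<dots> \<le> ennreal (K * (?v * (2 * t) ^ ?n))"
      using S(4) v \<open>0 < t\<close> by (intro ennreal_leI mult_right_mono) auto
    finally show ?thesis .
  qed
  have pow: "(2 * t) ^ ?n * 8 ^ ?n = 16 ^ ?n * t ^ ?n"
  proof -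
    have "(2 * t) ^ ?n * 8 ^ ?n = (2 * t * 8) ^ ?n" by (rule power_mult_distrib[symmetric])
    also have "2 * t * 8 = 16 * t" by simp
    also have "\<dots> ^ ?n = 16 ^ ?n * t ^ ?n" by (rule power_mult_distrib)
    finally show ?thesis .
  qed
  have bound: "K * (?v * (2 * t) ^ ?n) \<le> ?v * 16 ^ ?n * (\<beta> / \<alpha> * ?D powr Q + 1) * (t ^ ?n * (t powr (- Q) + 1))"
    if K: "K \<le> 8 ^ ?n * ((\<beta> / \<alpha> * ?D powr Q + 1) * (t powr (- Q) + 1))" for K
  proof -
    have "K * (?v * (2 * t) ^ ?n) \<le>
        8 ^ ?n * ((\<beta> / \<alpha> * ?D powr Q + 1) * (t powr (- Q) + 1)) * (?v * (2 * t) ^ ?n)"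
      using K v \<open>0 < t\<close> by (intro mult_right_mono) auto
    also have "\<dots> = ?v * ((2 * t) ^ ?n * 8 ^ ?n) * (\<beta> / \<alpha> * ?D powr Q + 1) * (t powr (- Q) + 1)"
      by (simp only: mult_ac)
    also have "\<dots> = ?v * 16 ^ ?n * (\<beta> / \<alpha> * ?D powr Q + 1) * (t ^ ?n * (t powr (- Q) + 1))"
      unfolding pow by (simp only: mult_ac)
    finally show ?thesis .
  qed
  \<comment> \<open>For \<open>t < 2 * ?D\<close> the radius \<open>t / 2\<close> is below the
    diameter, so lower regularity applies to the disjoint balls. Otherwise the ball of radius
    \<open>t\<close> about any point of \<open>E\<close> contains \<open>E\<close>; this includes
    the singletons, of diameter 0.\<close>
  show ?thesis
  proof (cases "t < 2 * ?D")
    case False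
    obtain p where p: "p \<in> E" using E(2) by blast
    have "E \<subseteq> (\<Union>s\<in>{p}. cball s t)"
      using diameter_bounded_bound[OF bE p] False D0 by fastforce
    moreover have "1 \<le> 8 ^ ?n * ((\<beta> / \<alpha> * ?D powr Q + 1) * (t powr (- Q) + 1))"
    proof -
      have "1 * (1 * 1) \<le> 8 ^ ?n * ((\<beta> / \<alpha> * ?D powr Q + 1) * (t powr (- Q) + 1))"
        using ab by (intro mult_mono) auto
      then show ?thesis by simp
    qed
    ultimately show ?thesis
      using order_trans[OF main[of "{p}" 1] ennreal_leI[OF bound[of 1]]] p by auto
  next
    case True
    then have Dpos: "0 < ?D" using \<open>0 < t\<close> by linarith
    obtain M where M: "sets M = sets borel" "\<And>A. A \<in> sets borel \<Longrightarrow> emeasure M A = \<mu> A"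
      using borel_regular_outer_measure_imp_measure[OF \<mu>(1)] by blast
    have mass: "emeasure M UNIV \<le> ennreal (8 ^ ?n * (\<beta> * (?D / 2) powr Q))"
      using \<mu>(2) \<mu>ball ab cE M Dpos E(1) by (intro regular_set_total_mass) (auto simp: is_spt_def)
    obtain S where S: "finite S" "S \<subseteq> E" "pairwise (\<lambda>x y. t \<le> dist x y) S" "E \<subseteq> (\<Union>s\<in>S. ball s t)"
      using finite_separated_net[OF bE \<open>0 < t\<close>] by metis
    have "of_nat (card S) * ennreal (\<alpha> * (t / 2) powr Q) \<le> emeasure M UNIV"
      using S M \<mu>ball True \<open>0 < t\<close>
      by (intro separated_card_times_le_emeasure[where \<epsilon> = t]) (auto simp: subset_iff)
    also note mass
    finally have "ennreal (real (card S) * (\<alpha> * (t / 2) powr Q)) \<le> ennreal (8 ^ ?n * (\<beta> * (?D / 2) powr Q))"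
      using ab by (simp add: ennreal_mult ennreal_of_nat_eq_real_of_nat)
    then have "real (card S) * (\<alpha> * (t / 2) powr Q) \<le> 8 ^ ?n * (\<beta> * (?D / 2) powr Q)"
      using ab by (subst (asm) ennreal_le_iff) auto
    \<comment> \<open>The halves cancel: \<open>(?D / 2) powr Q\<close> and
      \<open>(t / 2) powr Q\<close> carry the same factor.\<close>
    then have "real (card S) \<le> 8 ^ ?n * (\<beta> / \<alpha> * ?D powr Q * t powr (- Q))"
      using ab \<open>0 < t\<close> Dpos by (simp add: powr_divide powr_minus field_simps)
    also have "\<dots> \<le> 8 ^ ?n * ((\<beta> / \<alpha> * ?D powr Q + 1) * (t powr (- Q) + 1))"
      using ab by (intro mult_left_mono mult_mono) auto
    finally have card: "real (card S) \<le> 8 ^ ?n * ((\<beta> / \<alpha> * ?D powr Q + 1) * (t powr (- Q) + 1))" .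
    have cover: "E \<subseteq> (\<Union>s\<in>S. cball s t)"
      using S(4) by (rule order_trans) (intro UN_mono order_refl ball_subset_cball)
    show ?thesis
      using main[OF S(2,1) cover card] ennreal_leI[OF bound[OF order_refl]] by (rule order_trans)
  qed
qed

section \<open>Volume growth\<close>

text \<open>The bound is uniform in \<open>J\<close>, so the number of shells does not multiply the
  exponentially growing term.\<close>

lemma sum_exp_geometric_le:
  assumes "0 < (Q::real)"
  shows "(\<Sum>j<J. exp (- Q * real j)) \<le> 1 / (1 - exp (- Q))"
proof -
  have "(\<Sum>j<J. exp (- Q * real j)) = (\<Sum>j<J. exp (- Q) ^ j)"
    by (simp add: exp_of_nat_mult[symmetric] mult.commute)
  also have "\<dots> = (1 - exp (- Q) ^ J) / (1 - exp (- Q))"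
    using assms by (subst sum_gp_strict) auto
  also have "\<dots> \<le> 1 / (1 - exp (- Q))"
    using assms by (intro divide_right_mono) auto
  finally show ?thesis .
qed

text \<open>\<open>a\<close> bounds \<open>bdist G\<close> from below on the ball. A point lies in
  the shell of index \<open>\<lfloor>ln (bdist G z / a)\<rfloor>\<close>, between 0 and
  \<open>2 * r\<close>. The density is bounded by its value at the inner radius, and the shell is
  enlarged to the whole neighbourhood up to its outer radius.\<close>

lemma qh_ball_volume_le_sum:
  fixes G :: "'a::euclidean_space set"
  assumes G: "proper_subdomain G" and x: "x \<in> G" and "0 \<le> r"
    and a: "a = bdist G x * exp (- r)"
  shows "qh_volume G (qh_ball G x r) \<le>
    (\<Sum>j<Suc (nat \<lfloor>2 * r\<rfloor>). ennreal (1 / (a * exp (real j)) ^ DIM('a)) *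
       emeasure lborel {z. infdist z (frontier G) \<le> a * exp (real j + 1)})"
proof -
  define J where "J = Suc (nat \<lfloor>2 * r\<rfloor>)"
  let ?A = "\<lambda>j::nat. {z. infdist z (frontier G) \<le> a * exp (real j + 1)}"
  let ?c = "\<lambda>j::nat. ennreal (1 / (a * exp (real j)) ^ DIM('a))"
  have apos: "0 < a" using bdist_pos[OF G x] by (simp add: a)
  have A: "?A j \<in> sets borel" for j
    by (intro borel_closed closed_Collect_le continuous_intros)
  have "ennreal (1 / bdist G z ^ DIM('a)) * indicator (qh_ball G x r) z \<le>
      (\<Sum>j<J. ?c j * indicator (?A j) z)" for z
  proof (cases "z \<in> qh_ball G x r")
    case True
    then have z: "z \<in> G" "qh_dist G x z < ennreal r" by (auto simp: qh_ball_def)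
    have lo: "a \<le> bdist G z" and hi: "bdist G z \<le> bdist G x * exp r"
      using qh_dist_imp_bdist_bounds[OF G x z] by (simp_all add: a)
    have zpos: "0 < bdist G z" using apos lo by linarith
    define l where "l = ln (bdist G z / a)"
    have l: "bdist G z = a * exp l" using apos zpos by (simp add: l_def)
    have l0: "0 \<le> l" using lo apos by (simp add: l)
    have "a * exp l \<le> a * exp (2 * r)"
      using hi apos by (simp add: l a mult.assoc flip: exp_add)
    then have l2: "l \<le> 2 * r" using apos by simp
    define j where "j = nat \<lfloor>l\<rfloor>"
    have j: "real j \<le> l" "l \<le> real j + 1" "j < J"
      using l0 l2 by (auto simp: J_def j_def less_Suc_eq_le intro!: nat_mono floor_mono)
    have "z \<in> ?A j" using j(2) apos by (simp add: l flip: bdist_def)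
    moreover have "ennreal (1 / bdist G z ^ DIM('a)) \<le> ?c j"
      using apos j(1) by (intro ennreal_leI divide_left_mono power_mono) (auto simp: l)
    ultimately have "ennreal (1 / bdist G z ^ DIM('a)) * indicator (qh_ball G x r) z \<le> ?c j * indicator (?A j) z"
      using True by simp
    also have "\<dots> \<le> (\<Sum>j<J. ?c j * indicator (?A j) z)"
      using j(3) by (intro member_le_sum) auto
    finally show ?thesis .
  qed simp
  then have "qh_volume G (qh_ball G x r) \<le> (\<integral>\<^sup>+z. (\<Sum>j<J. ?c j * indicator (?A j) z) \<partial>lebesgue)"
    unfolding qh_volume_def by (intro nn_integral_mono)
  \<comment> \<open>On the Borel sets \<open>?A j\<close> the completed measure agrees with
    \<open>lborel\<close>.\<close>
  also have "\<dots> = (\<Sum>j<J. ?c j * emeasure lborel (?A j))"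
    using A by (subst nn_integral_sum) (auto simp: nn_integral_cmult_indicator intro!: measurable_completion)
  finally show ?thesis by (simp only: J_def)
qed

text \<open>With \<open>t = a * exp (j + 1)\<close> the factor \<open>t ^ n\<close> cancels the
  density of shell \<open>j\<close> up to \<open>exp 1 ^ n\<close>, leaving
  \<open>t powr (- Q) + 1\<close>. The first term is summed as a geometric series, the second counts
  at most \<open>2 * r + 1\<close> shells.\<close>

lemma qh_ball_volume_le:
  fixes G :: "'a::euclidean_space set"
  assumes G: "proper_subdomain G" "compact (frontier G)" and reg: "regular_set Q \<alpha> \<beta> (frontier G)"
    and x: "x \<in> G" and "0 \<le> r"
  shows "qh_volume G (qh_ball G x r) \<le>
    ennreal (unit_ball_vol DIM('a) * 16 ^ DIM('a) * (\<beta> / \<alpha> * diameter (frontier G) powr Q + 1) * exp 1 ^ DIM('a) *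
      (bdist G x powr (- Q) / (1 - exp (- Q)) * exp (Q * r) + (2 * r + 1)))"
proof -
  let ?n = "DIM('a)" and ?J = "Suc (nat \<lfloor>2 * r\<rfloor>)"
  let ?A = "\<lambda>j::nat. {z. infdist z (frontier G) \<le> a * exp (real j + 1)}"
  define a where "a = bdist G x * exp (- r)"
  define K where "K = unit_ball_vol ?n * 16 ^ ?n * (\<beta> / \<alpha> * diameter (frontier G) powr Q + 1)"
  have Q: "0 < Q" "0 < \<alpha>" "\<alpha> \<le> \<beta>" using reg by (auto simp: regular_set_def)
  have K: "0 \<le> K" using Q by (auto simp: K_def intro!: mult_nonneg_nonneg add_nonneg_nonneg)
  have dpos: "0 < bdist G x" by (rule bdist_pos[OF G(1) x])
  then have apos: "0 < a" by (simp add: a_def)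
  have termwise: "ennreal (1 / (a * exp (real j)) ^ ?n) *
       emeasure lborel {z. infdist z (frontier G) \<le> a * exp (real j + 1)}
     \<le> ennreal (K * exp 1 ^ ?n * (a powr (- Q) * exp (- Q * real j) + 1))" for j
  proof -
    let ?t = "a * exp (real j + 1)"
    have "ennreal (1 / (a * exp (real j)) ^ ?n) * emeasure lborel {z. infdist z (frontier G) \<le> ?t}
      \<le> ennreal (1 / (a * exp (real j)) ^ ?n) * ennreal (K * (?t ^ ?n * (?t powr (- Q) + 1)))"
      unfolding K_def using apos
      by (intro mult_left_mono regular_set_neighbourhood_volume[OF reg G(2)]
          proper_subdomain_frontier_nonempty G(1)) auto
    also have "\<dots> = ennreal (1 / (a * exp (real j)) ^ ?n * (K * (?t ^ ?n * (?t powr (- Q) + 1))))"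
      using apos by (intro ennreal_mult'[symmetric]) simp
    also have "1 / (a * exp (real j)) ^ ?n * (K * (?t ^ ?n * (?t powr (- Q) + 1))) =
        K * exp 1 ^ ?n * (?t powr (- Q) + 1)"
      using apos by (simp add: exp_add power_mult_distrib)
    also have "ennreal \<dots> \<le> ennreal (K * exp 1 ^ ?n * (a powr (- Q) * exp (- Q * real j) + 1))"
    proof (intro ennreal_leI mult_left_mono add_right_mono)
      have "?t powr (- Q) = a powr (- Q) * exp (- Q * (real j + 1))"
        using apos by (simp add: powr_mult exp_powr_real mult.commute)
      \<comment> \<open>A surplus factor \<open>exp (- Q)\<close> below 1 is dropped.\<close>
      also have "\<dots> \<le> a powr (- Q) * exp (- Q * real j)"
        using Q by (intro mult_left_mono) auto
      finally show "?t powr (- Q) \<le> a powr (- Q) * exp (- Q * real j)" .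
    qed (use K in auto)
    finally show ?thesis .
  qed
  \<comment> \<open>The growth rate \<open>exp (Q * r)\<close> comes from here: the innermost shell
    starts at distance \<open>bdist G x * exp (- r)\<close> from the frontier.\<close>
  have apQ: "a powr (- Q) = bdist G x powr (- Q) * exp (Q * r)"
    using dpos by (simp add: a_def powr_mult exp_powr_real mult.commute)
  have "qh_volume G (qh_ball G x r) \<le> (\<Sum>j<?J. ennreal (K * exp 1 ^ ?n * (a powr (- Q) * exp (- Q * real j) + 1)))"
    using qh_ball_volume_le_sum[OF G(1) x \<open>0 \<le> r\<close> a_def] sum_mono[OF termwise] by (rule order_trans)
  also have "\<dots> = ennreal (\<Sum>j<?J. K * exp 1 ^ ?n * (a powr (- Q) * exp (- Q * real j) + 1))"
    using K by (intro sum_ennreal) auto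
  also have "(\<Sum>j<?J. K * exp 1 ^ ?n * (a powr (- Q) * exp (- Q * real j) + 1)) =
      K * exp 1 ^ ?n * (a powr (- Q) * (\<Sum>j<?J. exp (- Q * real j)) + real ?J)"
    by (simp only: sum_distrib_left[symmetric] sum.distrib) simp
  also have "ennreal \<dots> \<le> ennreal (K * exp 1 ^ ?n * (a powr (- Q) * (1 / (1 - exp (- Q))) + (2 * r + 1)))"
  proof (intro ennreal_leI mult_left_mono add_mono sum_exp_geometric_le Q(1))
    show "real ?J \<le> 2 * r + 1" using \<open>0 \<le> r\<close> by linarith
  qed (use K in auto)
  finally show ?thesis unfolding apQ K_def by simp
qed

theorem theorem5p2:
  fixes Q \<alpha> \<beta> D \<delta> :: real
  assumes "CARD('n::finite) \<ge> 2"
  shows "\<exists>C::real. \<forall>(G :: (real ^ 'n) set) x.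
           proper_subdomain G \<and> compact (frontier G) \<and>
           regular_set Q \<alpha> \<beta> (frontier G) \<and> diameter (frontier G) = D \<and>
           x \<in> G \<and> bdist G x = \<delta> \<longrightarrow>
           (\<forall>\<^sub>F r in at_top. qh_volume G (qh_ball G x r) \<le> ennreal (C * exp (Q * r)))"
proof -
  define n where "n = DIM(real ^ 'n)"
  define K where "K = unit_ball_vol n * 16 ^ n * (\<beta> / \<alpha> * D powr Q + 1) * exp 1 ^ n"
  \<comment> \<open>The witness is fixed before \<open>G\<close> and \<open>x\<close>, so it depends
    only on the regularity data and \<open>\<delta>\<close>. Its summand \<open>+ 1\<close> absorbs
    the linear count of shells.\<close>
  show ?thesis
  proof (rule exI[of _ "K * (\<delta> powr (- Q) / (1 - exp (- Q)) + 1)"], intro allI impI, elim conjE)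
    fix G :: "(real ^ 'n) set" and x
    assume G: "proper_subdomain G" "compact (frontier G)" "regular_set Q \<alpha> \<beta> (frontier G)"
      "diameter (frontier G) = D" "x \<in> G" "bdist G x = \<delta>"
    have Q: "0 < Q" "0 < \<alpha>" "\<alpha> \<le> \<beta>" using G(3) by (auto simp: regular_set_def)
    have K: "0 \<le> K" using Q by (auto simp: K_def intro!: mult_nonneg_nonneg add_nonneg_nonneg)
    \<comment> \<open>Here \<open>r\<close> has to be large: the exponential overtakes the linear
      term because \<open>0 < Q\<close>.\<close>
    have "\<forall>\<^sub>F r in at_top. 2 * r + 1 \<le> exp (Q * r)" using Q(1) by real_asymp
    then show "\<forall>\<^sub>F r in at_top. qh_volume G (qh_ball G x r) \<le>
        ennreal (K * (\<delta> powr (- Q) / (1 - exp (- Q)) + 1) * exp (Q * r))"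
      using eventually_ge_at_top[of 0]
    proof eventually_elim
      case (elim r)
      have "qh_volume G (qh_ball G x r) \<le>
          ennreal (K * (\<delta> powr (- Q) / (1 - exp (- Q)) * exp (Q * r) + (2 * r + 1)))"
        using qh_ball_volume_le[OF G(1,2,3,5) elim(2)] by (simp only: K_def n_def G(4,6))
      also have "\<dots> \<le> ennreal (K * (\<delta> powr (- Q) / (1 - exp (- Q)) * exp (Q * r) + exp (Q * r)))"
        using K elim(1) by (intro ennreal_leI mult_left_mono) auto
      also have "K * (\<delta> powr (- Q) / (1 - exp (- Q)) * exp (Q * r) + exp (Q * r)) =
          K * (\<delta> powr (- Q) / (1 - exp (- Q)) + 1) * exp (Q * r)"
        by (simp only: algebra_simps)
      finally show ?case .
    qed
  qed
qed

end
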